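(* Let $r\ge3$ and fix $\alpha,\beta\in\mathbb{Z}_{\ge0}$. Let $\mathcal{P}_n$ be the maximal Dyck path corresponding to the cluster monomial $X_n^\alpha X_{n+1}^\beta$ in $\mathcal{A}(r,r)$, let $\mathrm{CP}(\mathcal{P}_n)$ be the set of compatible pairs on $\mathcal{P}_n$ and $\mathrm{CP}_+(\mathcal{P}_n)$ the set of those that are positive. Then $$\lim_{n\to\infty}\frac{|\mathrm{CP}_+(\mathcal{P}_n)|}{|\mathrm{CP}(\mathcal{P}_n)|}=1 .$$
   Context: $c_0=-1$, $c_1=0$, $c_n=rc_{n-1}-c_{n-2}$. For integers $\ell,h\ge 0$, $\mathcal{P}(\ell,h)$ is the maximal Dyck path: the lattice path from $(0,0)$ to $(\ell,h)$ with unit east and north steps that is closest to the diagonal without going strictly above it. For $n\ge3$ the path corresponding to the cluster variable $X_n$ is $\mathcal{P}(c_{n-1},c_{n-2})$, and the path corresponding to $X_n^\alpha X_{n+1}^\beta$ is $\mathcal{P}_n=\mathcal{P}(\alpha c_{n-1}+\beta c_n,\ \alpha c_{n-2}+\beta c_{n-1})$. For an edge $e$, $p_e$ is its left endpoint if $e$ is horizontal and its top endpoint if $e$ is vertical. For edges $e,f$, $\overrightarrow{ef}$ is the subpath going forward from $p_e$ to $p_f$, continuing cyclically around the path (with $(\ell,h)$ identified with $(0,0)$) if necessary; similarly for vertices. $|uw|_1$ and $|uw|_2$ are the numbers of horizontal and vertical edges of $\overrightarrow{uw}$. Given a set $S_1$ of horizontal edges and a set $S_2$ of vertical edges, $(S_1,S_2)$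 is compatible if for all $e\in S_1$, $f\in S_2$ there is a lattice point $t\ne p_e,p_f$ on $\overrightarrow{ef}$ with $|tp_f|_1=r|\overrightarrow{tp_f}\cap S_2|$ or $|p_et|_2=r|\overrightarrow{p_et}\cap S_1|$. A compatible pair on $\mathcal{P}(\ell,h)$ is positive if $r|S_2|\le\ell$. *)

theory Defs
  imports Complex_Main
begin

fun cseq :: "nat \<Rightarrow> nat \<Rightarrow> int" where
  "cseq r 0 = - 1"
| "cseq r (Suc 0) = 0"
| "cseq r (Suc (Suc n)) = int r * cseq r (Suc n) - cseq r n"

datatype step = East | North

definition lattice_path :: "nat \<Rightarrow> nat \<Rightarrow> step list \<Rightarrow> bool" where
  "lattice_path l h w \<longleftrightarrow> count_list w East = l \<and> count_list w North = h"

text \<open>A lattice point \<open>(x, y)\<close> is not strictly above the diagonal from \<open>(0, 0)\<close> to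
  \<open>(l, h)\<close> iff \<open>l * y \<le> h * x\<close>.\<close>
definition dyck_path :: "nat \<Rightarrow> nat \<Rightarrow> step list \<Rightarrow> bool" where
  "dyck_path l h w \<longleftrightarrow> lattice_path l h w \<and>
     (\<forall>k \<le> length w. l * count_list (take k w) North \<le> h * count_list (take k w) East)"

text \<open>Closest to the diagonal: every other Dyck path runs weakly below. Points reached after
  the same number of steps lie on a common antidiagonal, so they are compared by height.\<close>
definition maximal_dyck_path :: "nat \<Rightarrow> nat \<Rightarrow> step list \<Rightarrow> bool" where
  "maximal_dyck_path l h w \<longleftrightarrow> dyck_path l h w \<and>
     (\<forall>v. dyck_path l h v \<longrightarrow>
        (\<forall>k \<le> l + h. count_list (take k v) North \<le> count_list (take k w) North))"

definition max_dyck :: "nat \<Rightarrow> nat \<Rightarrow> step list" where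
  "max_dyck l h = (THE w. maximal_dyck_path l h w)"

lemma length_step_list: "length w = count_list w East + count_list w North"
proof (induction w)
  case (Cons a w)
  then show ?case by (cases a) auto
qed simp

lemma dyck_path_length: "dyck_path l h w \<Longrightarrow> length w = l + h"
  by (simp add: dyck_path_def lattice_path_def length_step_list)

lemma dyck_path_height_le:
  assumes "dyck_path l h w" "k \<le> l + h"
  shows "(l + h) * count_list (take k w) North \<le> h * k"
proof -
  have len: "length w = l + h" using assms(1) by (rule dyck_path_length)
  have "k = count_list (take k w) East + count_list (take k w) North"
    using assms(2) len length_step_list[of "take k w"] by simp
  then have "h * k = h * count_list (take k w) East + h * count_list (take k w) North"
    by (metis distrib_left)
  moreover have "l * count_list (take k w) North \<le> h * count_list (take k w) East"
    using assms len by (simp add: dyck_path_def)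
  ultimately show ?thesis by (simp add: algebra_simps)
qed

lemma maximal_dyck_path_unique:
  assumes "maximal_dyck_path l h v" "maximal_dyck_path l h w"
  shows "v = w"
proof (rule nth_equalityI)
  have len: "length v = l + h" "length w = l + h"
    using assms by (auto simp: maximal_dyck_path_def dyck_path_length)
  then show "length v = length w" by simp
  fix i assume i: "i < length v"
  have eq: "count_list (take k v) North = count_list (take k w) North" if "k \<le> l + h" for k
    using assms that by (meson maximal_dyck_path_def le_antisym)
  have "count_list (take (Suc i) v) North = count_list (take (Suc i) w) North"
    "count_list (take i v) North = count_list (take i w) North"
    using eq i len by auto
  then show "v ! i = w ! i"
    using i len by (cases "v ! i"; cases "w ! i") (auto simp: take_Suc_conv_app_nth)
qed

definition floor_path :: "nat \<Rightarrow> nat \<Rightarrow> step list" where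
  "floor_path l h =
     map (\<lambda>k. if h * k div (l + h) < h * Suc k div (l + h) then North else East) [0..<l + h]"

lemma floor_path_height:
  "k \<le> l + h \<Longrightarrow> count_list (take k (floor_path l h)) North = h * k div (l + h)"
proof (induction k)
  case (Suc k)
  have pos: "0 < l + h" using Suc.prems by linarith
  have "h * Suc k \<le> h * k + (l + h)" by simp
  then have "h * Suc k div (l + h) \<le> (h * k + (l + h)) div (l + h)" by (rule div_le_mono)
  also have "\<dots> = h * k div (l + h) + 1" using pos by (intro div_add_self2) simp
  finally have up: "h * Suc k div (l + h) \<le> h * k div (l + h) + 1" .
  have lo: "h * k div (l + h) \<le> h * Suc k div (l + h)" by (rule div_le_mono) simp
  have "take (Suc k) (floor_path l h) = take k (floor_path l h) @ [floor_path l h ! k]"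
    using Suc.prems by (simp add: take_Suc_conv_app_nth floor_path_def)
  then have "count_list (take (Suc k) (floor_path l h)) North =
      h * k div (l + h) + count_list [floor_path l h ! k] North"
    using Suc by simp
  also have "floor_path l h ! k =
      (if h * k div (l + h) < h * Suc k div (l + h) then North else East)"
    using Suc.prems by (simp add: floor_path_def)
  finally show ?case using up lo by (auto split: if_splits)
qed simp

lemma maximal_floor_path: "maximal_dyck_path l h (floor_path l h)"
proof -
  let ?w = "floor_path l h"
  have len: "length ?w = l + h" by (simp add: floor_path_def)
  have "count_list ?w North = h"
  proof (cases "l + h = 0")
    case False
    then show ?thesis using floor_path_height[of "l + h" l h] len
      by (metis le_refl nonzero_mult_div_cancel_right take_all)
  qed (simp add: floor_path_def)
  then have lp: "lattice_path l h ?w"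
    using len length_step_list[of ?w] by (simp add: lattice_path_def)
  have "l * count_list (take k ?w) North \<le> h * count_list (take k ?w) East" if k: "k \<le> l + h" for k
  proof -
    have "(l + h) * count_list (take k ?w) North \<le> h * k"
      using floor_path_height[OF k] by simp
    moreover have "k = count_list (take k ?w) East + count_list (take k ?w) North"
      using k len length_step_list[of "take k ?w"] by simp
    then have "h * k = h * count_list (take k ?w) East + h * count_list (take k ?w) North"
      by (metis distrib_left)
    ultimately show ?thesis by (simp add: algebra_simps)
  qed
  then have d: "dyck_path l h ?w" using lp len by (simp add: dyck_path_def)
  have "count_list (take k v) North \<le> count_list (take k ?w) North"
    if v: "dyck_path l h v" and k: "k \<le> l + h" for v k
  proof (cases "l + h = 0")
    case False
    then show ?thesis
      using dyck_path_height_le[OF v k] floor_path_height[OF k]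
      by (simp add: less_eq_div_iff_mult_less_eq mult.commute)
  qed (use k in simp)
  then show ?thesis using d by (simp add: maximal_dyck_path_def)
qed

lemma max_dyck_eq: "max_dyck l h = floor_path l h"
  unfolding max_dyck_def
  by (rule the_equality) (auto intro: maximal_floor_path maximal_dyck_path_unique)

lemma maximal_max_dyck: "maximal_dyck_path l h (max_dyck l h)"
  by (simp add: max_dyck_eq maximal_floor_path)

text \<open>Edges of a path \<open>w\<close> are the indices \<open>i < length w\<close>. Its lattice points are the residues
  modulo \<open>length w\<close> (which identifies the two ends of the path), edge \<open>i\<close> running from point
  \<open>i\<close> to point \<open>i + 1\<close>.\<close>
definition hedges :: "step list \<Rightarrow> nat set" where
  "hedges w = {i. i < length w \<and> w ! i = East}"

lemma card_hedges: "card (hedges w) = count_list w East"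
  by (simp add: hedges_def count_list_eq_length_filter length_filter_conv_card eq_commute)

definition vedges :: "step list \<Rightarrow> nat set" where
  "vedges w = {i. i < length w \<and> w ! i = North}"

definition edge_pt :: "step list \<Rightarrow> nat \<Rightarrow> nat" where
  "edge_pt w e = (if w ! e = East then e else Suc e mod length w)"

text \<open>Number of edges of the cyclic forward subpath from point \<open>u\<close> to point \<open>v\<close>. If \<open>u = v\<close>
  this subpath is one full turn around the path, not the trivial path. This matters when a
  vertical edge \<open>f\<close> immediately precedes a horizontal edge \<open>e\<close>, so that \<open>p\<^sub>e = p\<^sub>f\<close>.\<close>
definition sub_len :: "step list \<Rightarrow> nat \<Rightarrow> nat \<Rightarrow> nat" where
  "sub_len w u v = (if u < v then v - u else length w + v - u)"

definition sub_edges :: "step list \<Rightarrow> nat \<Rightarrow> nat \<Rightarrow> nat set" where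
  "sub_edges w u v = (\<lambda>k. (u + k) mod length w) ` {0..<sub_len w u v}"

definition sub_points :: "step list \<Rightarrow> nat \<Rightarrow> nat \<Rightarrow> nat set" where
  "sub_points w u v = (\<lambda>k. (u + k) mod length w) ` {0..sub_len w u v}"

definition compatible :: "nat \<Rightarrow> step list \<Rightarrow> nat set \<Rightarrow> nat set \<Rightarrow> bool" where
  "compatible r w S1 S2 \<longleftrightarrow>
     (\<forall>e\<in>S1. \<forall>f\<in>S2. \<exists>t\<in>sub_points w (edge_pt w e) (edge_pt w f) - {edge_pt w e, edge_pt w f}.
        card (sub_edges w t (edge_pt w f) \<inter> hedges w)
          = r * card (sub_edges w t (edge_pt w f) \<inter> S2) \<or>
        card (sub_edges w (edge_pt w e) t \<inter> vedges w)
          = r * card (sub_edges w (edge_pt w e) t \<inter> S1))"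

definition CP :: "nat \<Rightarrow> step list \<Rightarrow> (nat set \<times> nat set) set" where
  "CP r w = {(S1, S2). S1 \<subseteq> hedges w \<and> S2 \<subseteq> vedges w \<and> compatible r w S1 S2}"

definition CP_pos :: "nat \<Rightarrow> step list \<Rightarrow> (nat set \<times> nat set) set" where
  "CP_pos r w = {(S1, S2) \<in> CP r w. r * card S2 \<le> card (hedges w)}"

text \<open>The maximal Dyck path of the cluster monomial \<open>X\<^sub>n\<^sup>\<alpha> X\<^sub>n\<^sub>+\<^sub>1\<^sup>\<beta>\<close>. For \<open>r \<ge> 2\<close> and \<open>n \<ge> 3\<close>
  both arguments of \<open>nat\<close> are nonnegative and the subtractions do not truncate; smaller \<open>n\<close>
  carry no meaning.\<close>
definition monomial_path :: "nat \<Rightarrow> nat \<Rightarrow> nat \<Rightarrow> nat \<Rightarrow> step list" where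
  "monomial_path r \<alpha> \<beta> n = max_dyck
     (nat (int \<alpha> * cseq r (n - 1) + int \<beta> * cseq r n))
     (nat (int \<alpha> * cseq r (n - 2) + int \<beta> * cseq r (n - 1)))"

lemma cseq_mono:
  assumes "2 \<le> r"
  shows "0 \<le> cseq r (Suc n) \<and> cseq r n \<le> cseq r (Suc n)"
proof (induction n)
  case (Suc n)
  have "2 * cseq r (Suc n) \<le> int r * cseq r (Suc n)"
    using assms Suc by (intro mult_right_mono) auto
  then show ?case using Suc by simp
qed simp

lemma finite_CP: "finite (CP r w)"
proof (rule finite_subset)
  show "CP r w \<subseteq> Pow {..<length w} \<times> Pow {..<length w}"
    by (auto simp: CP_def hedges_def vedges_def)
qed simp

lemma empty_in_CP: "({}, {}) \<in> CP r w"
  by (simp add: CP_def compatible_def)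

end

theory Submission
  imports Defs
begin

text \<open>
  Let \<open>l\<close> and \<open>h\<close> be the numbers of horizontal and vertical edges. All pairs \<open>(S\<^sub>1, {})\<close> are
  compatible, so there are at least \<open>2 ^ l\<close> compatible pairs, and it is enough to show that the
  pairs that are not positive are exponentially fewer than that.

  A pair that is not positive has \<open>r * |S\<^sub>2| > l\<close>, and this forces \<open>r * |S\<^sub>1| \<le> h\<close>
  (lemma \<open>nonpositive_pair_few_horizontal\<close>). Give each horizontal edge the weight \<open>1\<close> and take
  away \<open>r\<close> for each edge of \<open>S\<^sub>2\<close>. The total weight is negative, so by the argument of the cycle
  lemma some edge \<open>f\<close> of \<open>S\<^sub>2\<close> has negative weight on every subpath ending at its top endpoint.
  Against this \<open>f\<close> the first alternative in the compatibility condition always fails, so each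
  \<open>e\<close> in \<open>S\<^sub>1\<close> starts a subpath, ending before \<open>f\<close> does, on which the vertical edges are exactly
  \<open>r\<close> times as many as the edges of \<open>S\<^sub>1\<close>. Chaining such subpaths around the path covers
  \<open>S\<^sub>1\<close> and uses at most \<open>h\<close> vertical edges (lemma \<open>card_le_of_balanced_segments\<close>).

  There remain at most \<open>2 ^ h\<close> choices for \<open>S\<^sub>2\<close>, and at most
  \<open>(\<Sum>S\<^sub>1. 2 ^ h * (1/8) ^ |S\<^sub>1|) = 2 ^ h * (9/8) ^ l\<close> choices for \<open>S\<^sub>1\<close>, because \<open>3 * |S\<^sub>1| \<le> h\<close>
  makes every counted summand at least \<open>1\<close>. Finally \<open>5 * h \<le> 2 * l\<close> by the recurrence for
  \<open>c\<^sub>n\<close>, whence \<open>4 ^ h \<le> (7/4) ^ l\<close>. The proportion of pairs that are not positive is therefore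
  at most \<open>((7/4) * (9/8) / 2) ^ l = (63/64) ^ l\<close>, and \<open>l\<close> tends to infinity unless
  \<open>\<alpha> = \<beta> = 0\<close>, when every path is empty.
\<close>

section \<open>Cyclic subpaths\<close>

lemma card_vedges: "card (vedges w) = count_list w North"
  by (simp add: vedges_def count_list_eq_length_filter length_filter_conv_card eq_commute)

lemma finite_hedges: "finite (hedges w)" and finite_vedges: "finite (vedges w)"
  by (simp_all add: hedges_def vedges_def)

text \<open>Without the modular arithmetic, the weight of a cyclic subpath becomes a difference of
  prefix sums, corrected by the total weight when the subpath wraps around.\<close>
lemma sub_edges_eq:
  assumes "u < length w" "v < length w"
  shows "sub_edges w u v = (if u < v then {u..<v} else {u..<length w} \<union> {..<v})"
proof (cases "u < v")
  case True
  have "(\<lambda>k. (u + k) mod length w) ` {0..<v - u} = (\<lambda>k. u + k) ` {0..<v - u}"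
    using assms by (intro image_cong) auto
  then show ?thesis using True by (simp add: sub_edges_def sub_len_def)
next
  case False
  let ?N = "length w"
  have "{0..<?N + v - u} = {0..<?N - u} \<union> {?N - u..<?N - u + v}"
    using assms False by auto
  moreover have "(\<lambda>k. (u + k) mod ?N) ` {0..<?N - u} = (\<lambda>k. u + k) ` {0..<?N - u}"
    by (intro image_cong) auto
  then have "(\<lambda>k. (u + k) mod ?N) ` {0..<?N - u} = {u..<?N}"
    using assms by simp
  moreover have "(\<lambda>k. (u + k) mod ?N) ` {?N - u..<?N - u + v} = {..<v}"
  proof -
    have "(\<lambda>k. (u + k) mod ?N) ` {?N - u..<?N - u + v}
        = (\<lambda>k. (u + k) mod ?N) ` (\<lambda>k. k + (?N - u)) ` {0..<v}"
      by (simp add: add.commute)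
    also have "\<dots> = (\<lambda>k. k) ` {0..<v}"
      unfolding image_image using assms by (intro image_cong) auto
    finally show ?thesis by (simp add: lessThan_atLeast0)
  qed
  ultimately show ?thesis using False by (simp add: sub_edges_def sub_len_def image_Un)
qed

section \<open>An edge whose shadow is the whole path\<close>

text \<open>This is the cycle lemma in the form of prefix sums: the place wanted is the first one
  where the minimum is attained.\<close>
lemma first_minimum:
  fixes A :: "nat \<Rightarrow> int"
  assumes "A N < A 0"
  obtains q where "0 < q" "q \<le> N" "\<And>t. t < q \<Longrightarrow> A q < A t" "\<And>t. t \<le> N \<Longrightarrow> A q \<le> A t"
proof -
  define P where "P q \<longleftrightarrow> q \<le> N \<and> (\<forall>t\<le>N. A q \<le> A t)" for q
  define m where "m = Min (A ` {..N})"
  have "m \<in> A ` {..N}" unfolding m_def by (intro Min_in) auto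
  then obtain q0 where "q0 \<le> N" "A q0 = m" by auto
  then have "P q0" unfolding P_def m_def by auto
  then have q: "P (LEAST q. P q)" by (rule LeastI)
  define q where "q = (LEAST q. P q)"
  have Pq: "P q" using q by (simp add: q_def)
  show ?thesis
  proof (rule that[of q])
    show "q \<le> N" "\<And>t. t \<le> N \<Longrightarrow> A q \<le> A t" using Pq by (auto simp: P_def)
    show "0 < q" using Pq assms by (force simp: P_def intro: gr0I)
    show "A q < A t" if "t < q" for t
    proof -
      have "\<not> P t" using that not_less_Least unfolding q_def by blast
      then show ?thesis using that Pq by (force simp: P_def not_le)
    qed
  qed
qed

text \<open>The edge found here is the one just before the first minimum of the prefix sums of the
  weights; it lowers the prefix sum, and only edges of \<open>S\<^sub>2\<close> do so. If that minimum is
  reached at the very end of the path, the top endpoint of the edge is the point \<open>0\<close>.\<close>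
lemma exists_unbalanced_vertical:
  assumes S2: "S2 \<subseteq> vedges w" and big: "card (hedges w) < r * card S2"
  obtains f where "f \<in> S2"
    "\<And>t. t < length w \<Longrightarrow> t \<noteq> edge_pt w f \<Longrightarrow>
      card (sub_edges w t (edge_pt w f) \<inter> hedges w) < r * card (sub_edges w t (edge_pt w f) \<inter> S2)"
proof -
  define N where "N = length w"
  define H where "H = hedges w"
  define W where "W X = int (card (X \<inter> H)) - int r * int (card (X \<inter> S2))" for X
  have HN: "H \<subseteq> {..<N}" and SN: "S2 \<subseteq> {..<N}"
    using S2 by (auto simp: H_def N_def hedges_def vedges_def)
  have W_Un: "W (X \<union> Y) = W X + W Y" if "X \<inter> Y = {}" for X Y
  proof -
    have fin: "finite H" "finite S2"
      using HN SN finite_subset by blast+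
    have "card ((X \<union> Y) \<inter> Z) = card (X \<inter> Z) + card (Y \<inter> Z)" if "finite Z" for Z
      unfolding Int_Un_distrib2 using that \<open>X \<inter> Y = {}\<close> by (intro card_Un_disjoint) auto
    then show ?thesis unfolding W_def using fin by (simp add: algebra_simps)
  qed
  define A where "A k = W {..<k}" for k
  have seg: "W {s..<k} = A k - A s" if "s \<le> k" for s k
  proof -
    have "{..<k} = {..<s} \<union> {s..<k}" using that by auto
    moreover have "W ({..<s} \<union> {s..<k}) = W {..<s} + W {s..<k}" by (rule W_Un) auto
    ultimately show ?thesis by (simp add: A_def)
  qed
  have A0: "A 0 = 0" by (simp add: A_def W_def)
  have "{..<N} \<inter> H = H" "{..<N} \<inter> S2 = S2" using HN SN by auto
  then have "A N = int (card H) - int (r * card S2)" by (simp add: A_def W_def)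
  then have AN: "A N < 0" using big by (simp add: H_def flip: of_nat_mult)
  then have "A N < A 0" using A0 by simp
  then obtain q where q: "0 < q" "q \<le> N" and first: "\<And>t. t < q \<Longrightarrow> A q < A t"
    and least: "\<And>t. t \<le> N \<Longrightarrow> A q \<le> A t"
    using first_minimum by blast
  define f where "f = q - 1"
  have qf: "q = Suc f" using q by (simp add: f_def)
  have fS2: "f \<in> S2"
  proof (rule ccontr)
    assume "f \<notin> S2"
    then have "0 \<le> W {f..<q}" by (simp add: W_def qf)
    then show False using first[of f] seg[of f q] by (simp add: qf)
  qed
  define p where "p = edge_pt w f"
  have "w ! f = North" using fS2 S2 by (auto simp: vedges_def)
  then have p: "p = (if q < N then q else 0)"
    using q by (auto simp: p_def edge_pt_def qf N_def)
  have "W (sub_edges w t p) < 0" if t: "t < N" "t \<noteq> p" for t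
  proof (cases "t < p")
    case True
    then have "q < N" "p = q" using p by (auto split: if_splits)
    then show ?thesis
      using sub_edges_eq[of t w p] t True seg[of t q] first[of t] by (simp add: N_def)
  next
    case False
    have "W (sub_edges w t p) = W {t..<N} + W {..<p}"
      using sub_edges_eq[of t w p] t False W_Un[of "{t..<N}" "{..<p}"] by (force simp: N_def)
    then have *: "W (sub_edges w t p) = A N - A t + A p"
      using seg[of t N] t by (simp add: A_def)
    show ?thesis
    proof (cases "q < N")
      case True
      then show ?thesis using * AN least[of t] t p by simp
    next
      case False
      then have "q = N" "p = 0" using q p by auto
      then show ?thesis using * first[of t] t A0 by simp
    qed
  qed
  then have "card (sub_edges w t p \<inter> H) < r * card (sub_edges w t p \<inter> S2)"
    if "t < N" "t \<noteq> p" for t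
    using that by (simp add: W_def flip: of_nat_mult)
  then show ?thesis
    using that[OF fS2] by (simp add: p_def H_def N_def)
qed

section \<open>Chaining balanced segments\<close>

text \<open>Read the line from its right end: a point outside \<open>S\<close> can be skipped, and a point of
  \<open>S\<close> is the start of a segment where equality holds, behind which one continues.\<close>
lemma card_le_of_balanced_segments:
  fixes S V :: "nat set"
  assumes bal: "\<And>j. j \<in> S \<Longrightarrow> j < N \<Longrightarrow>
    \<exists>k. j < k \<and> k \<le> N \<and> card ({j..<k} \<inter> V) = r * card ({j..<k} \<inter> S)"
  shows "r * card ({..<N} \<inter> S) \<le> card ({..<N} \<inter> V)"
proof -
  have "r * card ({j..<N} \<inter> S) \<le> card ({j..<N} \<inter> V)" if "j \<le> N" for j
    using that
  proof (induction "N - j" arbitrary: j rule: less_induct)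
    case less
    have split: "card ({j..<N} \<inter> Z) = card ({j..<k} \<inter> Z) + card ({k..<N} \<inter> Z)"
      if "j \<le> k" "k \<le> N" for k Z
    proof -
      have "{j..<N} \<inter> Z = ({j..<k} \<inter> Z) \<union> ({k..<N} \<inter> Z)" using that by auto
      then show ?thesis by (simp add: card_Un_disjoint disjoint_iff)
    qed
    show ?case
    proof (cases "j < N")
      case False
      then show ?thesis by simp
    next
      case True
      obtain k where k: "j < k" "k \<le> N" "r * card ({j..<k} \<inter> S) \<le> card ({j..<k} \<inter> V)"
      proof (cases "j \<in> S")
        case True
        with bal[of j] \<open>j < N\<close> that show ?thesis by (metis order_refl)
      next
        case False
        with \<open>j < N\<close> that[of "Suc j"] show ?thesis by simp
      qed
      have "r * card ({k..<N} \<inter> S) \<le> card ({k..<N} \<inter> V)" using less.hyps[of k] k by simp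
      then show ?thesis using k split[of k S] split[of k V] by (simp add: algebra_simps)
    qed
  qed
  from this[of 0] show ?thesis by (simp add: lessThan_atLeast0)
qed

text \<open>The path is cut open at the top endpoint \<open>p\<close> of the edge \<open>f\<close> of
  \<open>exists_unbalanced_vertical\<close>, and \<open>\<rho> j\<close> is the \<open>j\<close>-th point after \<open>p\<close>. No balanced segment
  passes \<open>p\<close>, so on this line the segments may be chained.\<close>
lemma nonpositive_pair_few_horizontal:
  assumes cp: "(S1, S2) \<in> CP r w" and big: "card (hedges w) < r * card S2"
  shows "r * card S1 \<le> card (vedges w)"
proof -
  define N where "N = length w"
  have S1: "S1 \<subseteq> hedges w" and S2: "S2 \<subseteq> vedges w" and comp: "compatible r w S1 S2"
    using cp by (auto simp: CP_def)
  obtain f where f: "f \<in> S2" and unbal: "\<And>t. t < N \<Longrightarrow> t \<noteq> edge_pt w f \<Longrightarrow>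
      card (sub_edges w t (edge_pt w f) \<inter> hedges w) < r * card (sub_edges w t (edge_pt w f) \<inter> S2)"
    using exists_unbalanced_vertical[OF S2 big] unfolding N_def by blast
  define p where "p = edge_pt w f"
  have "f < N" using f S2 by (auto simp: vedges_def N_def)
  then have pN: "p < N" by (auto simp: p_def edge_pt_def N_def intro: mod_less_divisor)
  define \<rho> where "\<rho> j = (p + j) mod N" for j
  have \<rho>_if: "\<rho> j = (if p + j < N then p + j else p + j - N)" if "j \<le> N" for j
    using that pN by (auto simp: \<rho>_def le_mod_geq not_less)
  have \<rho>_inj: "inj_on \<rho> {..<N}" by (rule inj_onI) (auto simp: \<rho>_if split: if_splits)
  have \<rho>_img: "\<rho> ` {..<N} = {..<N}"
    by (rule endo_inj_surj) (use \<rho>_inj pN in \<open>auto simp: \<rho>_def\<close>)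
  define pull where "pull Z = {j. \<rho> j \<in> Z}" for Z
  have card_pull: "card (J \<inter> pull Z) = card (\<rho> ` J \<inter> Z)" if "J \<subseteq> {..<N}" for J Z
  proof -
    have "\<rho> ` (J \<inter> pull Z) = \<rho> ` J \<inter> Z" by (auto simp: pull_def)
    then show ?thesis using card_image[of \<rho> "J \<inter> pull Z"] inj_on_subset[OF \<rho>_inj] that
      by (metis le_infI1)
  qed
  \<comment> \<open>\<open>k = N\<close> is included: \<open>\<rho> N = p\<close>, and for \<open>j = 0\<close> this is the full turn.\<close>
  have len: "sub_len w (\<rho> j) (\<rho> k) = k - j" if "j < k" "k \<le> N" for j k
    using that pN \<rho>_if[of j] \<rho>_if[of k] by (auto simp: sub_len_def N_def)
  have shift: "(\<rho> j + i) mod length w = \<rho> (j + i)" for j i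
    by (simp add: \<rho>_def N_def mod_add_left_eq add.assoc)
  have edges: "sub_edges w (\<rho> j) (\<rho> k) = \<rho> ` {j..<k}" if "j < k" "k \<le> N" for j k
  proof -
    have "{j..<k} = (\<lambda>i. j + i) ` {0..<k - j}" using that by simp
    then show ?thesis
      unfolding sub_edges_def len[OF that] shift by (simp only: image_image)
  qed
  have points: "sub_points w (\<rho> j) p = \<rho> ` {j..N}" if "j < N" for j
  proof -
    have \<rho>N: "\<rho> N = p" using pN by (simp add: \<rho>_def)
    have "{j..N} = (\<lambda>i. j + i) ` {0..N - j}" using that by simp
    then show ?thesis
      using len[of j N] that unfolding sub_points_def \<rho>N shift by (simp only: image_image)
  qed
  have bal: "\<exists>k. j < k \<and> k \<le> N \<and>
      card ({j..<k} \<inter> pull (vedges w)) = r * card ({j..<k} \<inter> pull S1)"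
    if j: "j \<in> pull S1" "j < N" for j
  proof -
    have e: "\<rho> j \<in> S1" using j by (simp add: pull_def)
    then have "edge_pt w (\<rho> j) = \<rho> j" using S1 by (auto simp: edge_pt_def hedges_def)
    then obtain t where t: "t \<in> sub_points w (\<rho> j) p" "t \<noteq> \<rho> j" "t \<noteq> p"
      and alt: "card (sub_edges w t p \<inter> hedges w) = r * card (sub_edges w t p \<inter> S2) \<or>
        card (sub_edges w (\<rho> j) t \<inter> vedges w) = r * card (sub_edges w (\<rho> j) t \<inter> S1)"
      using comp e f unfolding compatible_def p_def by fastforce
    obtain k where k: "t = \<rho> k" "j \<le> k" "k \<le> N" using t points[OF j(2)] by auto
    have "j < k" using k t by (cases "j = k") auto
    have "t < N" using k pN by (simp add: \<rho>_def)
    then have "card (sub_edges w (\<rho> j) t \<inter> vedges w) = r * card (sub_edges w (\<rho> j) t \<inter> S1)"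
      using alt unbal[of t] t by (auto simp: p_def)
    then have "card ({j..<k} \<inter> pull (vedges w)) = r * card ({j..<k} \<inter> pull S1)"
      using edges[of j k] card_pull[of "{j..<k}"] k \<open>j < k\<close> by (simp add: subset_eq)
    then show ?thesis using \<open>j < k\<close> k by blast
  qed
  have "r * card ({..<N} \<inter> pull S1) \<le> card ({..<N} \<inter> pull (vedges w))"
    by (rule card_le_of_balanced_segments) (rule bal)
  moreover have "{..<N} \<inter> S1 = S1" "{..<N} \<inter> vedges w = vedges w"
    using S1 by (auto simp: hedges_def vedges_def N_def)
  ultimately show ?thesis using card_pull[of "{..<N}"] \<rho>_img by simp
qed

section \<open>Counting\<close>

lemma card_CP_ge: "2 ^ card (hedges w) \<le> card (CP r w)"
proof -
  have "(\<lambda>S. (S, {})) ` Pow (hedges w) \<subseteq> CP r w" by (auto simp: CP_def compatible_def)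
  then have "card ((\<lambda>S. (S, {}::nat set)) ` Pow (hedges w)) \<le> card (CP r w)"
    by (intro card_mono finite_CP)
  then show ?thesis
    by (simp add: card_image inj_on_def card_Pow finite_hedges)
qed

lemma sum_Pow_power_card:
  fixes x :: real
  assumes "finite A"
  shows "(\<Sum>S\<in>Pow A. x ^ card S) = (1 + x) ^ card A"
  using prod_add[OF assms, of "\<lambda>_. x" "\<lambda>_. 1"] by (simp add: add.commute)

text \<open>The Chernoff bound with the weight \<open>1/8\<close> for each element: \<open>1 \<le> 2 ^ (h - 3 * |S|)\<close> for
  every set that is counted.\<close>
lemma card_small_subsets_le:
  assumes "finite A"
  shows "real (card {S. S \<subseteq> A \<and> 3 * card S \<le> h}) \<le> 2 ^ h * (9/8) ^ card A"
proof -
  let ?T = "{S. S \<subseteq> A \<and> 3 * card S \<le> h}"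
  have "real (card ?T) = (\<Sum>S\<in>?T. 1)" by simp
  also have "\<dots> \<le> (\<Sum>S\<in>?T. 2 ^ h * (1/8) ^ card S)"
  proof (rule sum_mono)
    fix S assume "S \<in> ?T"
    then have "(2::real) ^ (3 * card S) \<le> 2 ^ h" by (intro power_increasing) auto
    then have "(8::real) ^ card S \<le> 2 ^ h" unfolding power_mult by simp
    then show "(1::real) \<le> 2 ^ h * (1/8) ^ card S"
      by (simp add: power_one_over field_simps)
  qed
  also have "\<dots> \<le> (\<Sum>S\<in>Pow A. 2 ^ h * (1/8) ^ card S)"
    by (rule sum_mono2) (use assms in auto)
  also have "\<dots> = 2 ^ h * (9/8) ^ card A"
    using sum_Pow_power_card[OF assms, of "1/8"] by (simp flip: sum_distrib_left)
  finally show ?thesis .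
qed

lemma card_nonpositive_le:
  assumes "r \<ge> 3"
  shows "real (card (CP r w - CP_pos r w)) \<le> 4 ^ card (vedges w) * (9/8) ^ card (hedges w)"
proof -
  let ?h = "card (vedges w)"
  let ?T = "{S. S \<subseteq> hedges w \<and> 3 * card S \<le> ?h}"
  have sub: "CP r w - CP_pos r w \<subseteq> ?T \<times> Pow (vedges w)"
  proof
    fix x assume x: "x \<in> CP r w - CP_pos r w"
    obtain S1 S2 where [simp]: "x = (S1, S2)" by (cases x)
    have "r * card S1 \<le> ?h"
      using x by (intro nonpositive_pair_few_horizontal) (auto simp: CP_pos_def)
    then have "3 * card S1 \<le> ?h" using assms by (meson le_trans mult_le_mono1)
    then show "x \<in> ?T \<times> Pow (vedges w)" using x by (auto simp: CP_def)
  qed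
  have "card (CP r w - CP_pos r w) \<le> card (?T \<times> Pow (vedges w))"
    by (rule card_mono) (use sub finite_hedges finite_vedges in auto)
  also have "\<dots> = card ?T * 2 ^ ?h"
    by (simp add: card_cartesian_product card_Pow finite_vedges)
  finally have "real (card (CP r w - CP_pos r w)) \<le> real (card ?T * 2 ^ ?h)"
    by (simp only: of_nat_le_iff)
  also have "\<dots> = real (card ?T) * 2 ^ ?h" by simp
  also have "\<dots> \<le> (2 ^ ?h * (9/8) ^ card (hedges w)) * 2 ^ ?h"
    by (intro mult_right_mono card_small_subsets_le finite_hedges) simp
  also have "\<dots> = 4 ^ ?h * (9/8) ^ card (hedges w)"
    by (simp add: flip: power_mult_distrib)
  finally show ?thesis .
qed

text \<open>The slope bound enters through \<open>4 ^ (2/5) \<le> 7/4\<close>, that is \<open>16 \<le> (7/4) ^ 5\<close>.\<close>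
lemma positive_ratio_ge:
  assumes "r \<ge> 3" and slope: "5 * card (vedges w) \<le> 2 * card (hedges w)"
  shows "1 - (63/64) ^ card (hedges w) \<le> real (card (CP_pos r w)) / real (card (CP r w))"
proof -
  let ?h = "card (vedges w)" and ?l = "card (hedges w)"
  let ?D = "real (card (CP r w - CP_pos r w))"
  have sub: "CP_pos r w \<subseteq> CP r w" by (auto simp: CP_pos_def)
  have "((4::real) ^ ?h) ^ 5 = 4 ^ (5 * ?h)" by (metis power_mult mult.commute)
  also have "\<dots> \<le> 4 ^ (2 * ?l)" using slope by (intro power_increasing) auto
  also have "\<dots> = 16 ^ ?l" by (simp add: power_mult)
  also have "\<dots> \<le> ((7/4) ^ 5) ^ ?l" by (rule power_mono) (simp_all add: power_divide)
  also have "\<dots> = ((7/4) ^ ?l) ^ 5" by (metis power_mult mult.commute)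
  finally have "((4::real) ^ ?h) ^ Suc 4 \<le> ((7/4) ^ ?l) ^ Suc 4" by simp
  then have h: "(4::real) ^ ?h \<le> (7/4) ^ ?l" by (rule power_le_imp_le_base) simp
  have l: "(2::real) ^ ?l \<le> real (card (CP r w))"
    using card_CP_ge[of w r] by (metis of_nat_le_iff of_nat_numeral of_nat_power)
  have "?D \<le> 4 ^ ?h * (9/8) ^ ?l" by (rule card_nonpositive_le) fact
  also have "\<dots> \<le> (7/4) ^ ?l * (9/8) ^ ?l" using h by (intro mult_right_mono) auto
  also have "\<dots> = (63/64) ^ ?l * 2 ^ ?l" by (simp flip: power_mult_distrib)
  also have "\<dots> \<le> (63/64) ^ ?l * real (card (CP r w))"
    using l by (intro mult_left_mono) auto
  finally have D: "?D \<le> (63/64) ^ ?l * real (card (CP r w))" .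
  have "?D = real (card (CP r w)) - real (card (CP_pos r w))"
    using card_Diff_subset[OF finite_subset[OF sub finite_CP] sub] card_mono[OF finite_CP sub]
    by (simp add: of_nat_diff)
  moreover have "0 < real (card (CP r w))"
    using finite_CP[of r w] empty_in_CP[of r w] by (auto simp: card_gt_0_iff)
  ultimately have "(1 - (63/64) ^ ?l) * real (card (CP r w)) \<le> real (card (CP_pos r w))"
    and "0 < real (card (CP r w))"
    using D by (simp_all add: left_diff_distrib)
  then show ?thesis by (simp add: pos_le_divide_eq)
qed

section \<open>Growth of the exponents\<close>

text \<open>The ratio of consecutive terms decreases to \<open>(r + sqrt (r\<^sup>2 - 4)) / 2\<close>, which for \<open>r = 3\<close> is
  about \<open>2.618\<close>; the bound \<open>5/2\<close> reproduces itself because \<open>3 - 2/5 \<ge> 5/2\<close>.\<close>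
lemma cseq_ratio:
  assumes "r \<ge> 3"
  shows "5 * cseq r (Suc n) \<le> 2 * cseq r (Suc (Suc n))"
proof (induction n)
  case (Suc n)
  have "0 \<le> cseq r (Suc (Suc n))" using cseq_mono[of r "Suc n"] assms by simp
  then have "3 * cseq r (Suc (Suc n)) \<le> int r * cseq r (Suc (Suc n))"
    using assms by (intro mult_right_mono) auto
  then have "cseq r (Suc (Suc (Suc n))) \<ge> 3 * cseq r (Suc (Suc n)) - cseq r (Suc n)" by simp
  then show ?case using Suc \<open>0 \<le> cseq r (Suc (Suc n))\<close> by linarith
qed simp

lemma cseq_ge:
  assumes "r \<ge> 3"
  shows "int n \<le> cseq r (Suc n)"
proof (induction n)
  case (Suc n)
  show ?case
  proof (cases n)
    case (Suc m)
    then show ?thesis using cseq_ratio[OF assms, of n] \<open>int n \<le> cseq r (Suc n)\<close> by linarith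
  qed simp
qed simp

lemma card_edges_max_dyck:
  "card (hedges (max_dyck l h)) = l" "card (vedges (max_dyck l h)) = h"
  using maximal_max_dyck[of l h]
  by (auto simp: card_hedges card_vedges maximal_dyck_path_def dyck_path_def lattice_path_def)

lemma monomial_path_slope:
  assumes "r \<ge> 3" "n \<ge> 3"
  shows "5 * card (vedges (monomial_path r \<alpha> \<beta> n)) \<le> 2 * card (hedges (monomial_path r \<alpha> \<beta> n))"
proof -
  define m where "m = n - 3"
  have n: "n = Suc (Suc (Suc m))" using assms(2) by (simp add: m_def)
  let ?a = "cseq r (Suc m)" and ?b = "cseq r (Suc (Suc m))" and ?c = "cseq r (Suc (Suc (Suc m)))"
  have "5 * ?a \<le> 2 * ?b" "5 * ?b \<le> 2 * ?c" using cseq_ratio[OF assms(1)] by blast+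
  then have "int \<alpha> * (5 * ?a) \<le> int \<alpha> * (2 * ?b)" "int \<beta> * (5 * ?b) \<le> int \<beta> * (2 * ?c)"
    by (auto intro: mult_left_mono)
  then have "5 * (int \<alpha> * ?a + int \<beta> * ?b) \<le> 2 * (int \<alpha> * ?b + int \<beta> * ?c)"
    by (simp only: algebra_simps)
  moreover have "5 * nat x \<le> 2 * nat y" if "5 * x \<le> 2 * y" for x y :: int
    using that by arith
  ultimately have "5 * nat (int \<alpha> * ?a + int \<beta> * ?b) \<le> 2 * nat (int \<alpha> * ?b + int \<beta> * ?c)"
    by blast
  then show ?thesis
    unfolding monomial_path_def card_edges_max_dyck
    by (simp only: n diff_Suc_Suc diff_Suc_1 numeral_2_eq_2 diff_zero)
qed

lemma monomial_path_width:
  assumes "r \<ge> 3" "n \<ge> 3" "\<alpha> + \<beta> > 0"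
  shows "n - 2 \<le> card (hedges (monomial_path r \<alpha> \<beta> n))"
proof -
  define m where "m = n - 2"
  have n: "n = Suc (Suc m)" using assms(2) by (simp add: m_def)
  let ?b = "cseq r (Suc m)" and ?c = "cseq r (Suc (Suc m))"
  have bc: "int m \<le> ?b" "int m \<le> ?c"
    using cseq_ge[OF assms(1), of m] cseq_ge[OF assms(1), of "Suc m"] by linarith+
  have "1 * int m \<le> (int \<alpha> + int \<beta>) * int m"
    using assms(3) by (intro mult_right_mono) auto
  also have "\<dots> = int \<alpha> * int m + int \<beta> * int m" by (simp add: algebra_simps)
  also have "\<dots> \<le> int \<alpha> * ?b + int \<beta> * ?c"
    using bc by (intro add_mono mult_left_mono) auto
  finally have "m \<le> nat (int \<alpha> * ?b + int \<beta> * ?c)" by linarith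
  then show ?thesis
    unfolding monomial_path_def card_edges_max_dyck
    by (simp only: n diff_Suc_Suc diff_Suc_1 numeral_2_eq_2 diff_zero)
qed

section \<open>The limit\<close>

theorem lemma2p7:
  fixes r \<alpha> \<beta> :: nat
  assumes "r \<ge> 3"
  shows "(\<lambda>n. real (card (CP_pos r (monomial_path r \<alpha> \<beta> n)))
            / real (card (CP r (monomial_path r \<alpha> \<beta> n)))) \<longlonglongrightarrow> 1"
proof (cases "\<alpha> + \<beta> > 0")
  case True
  let ?w = "monomial_path r \<alpha> \<beta>"
  let ?q = "\<lambda>n. real (card (CP_pos r (?w n))) / real (card (CP r (?w n)))"
  have lower: "1 - (63/64) ^ (n - 2) \<le> ?q n" if "n \<ge> 3" for n
  proof -
    have "(63/64::real) ^ card (hedges (?w n)) \<le> (63/64) ^ (n - 2)"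
      using monomial_path_width[OF assms that True] by (intro power_decreasing) auto
    then show ?thesis
      using positive_ratio_ge[OF assms monomial_path_slope[OF assms that, of \<alpha> \<beta>]] by linarith
  qed
  have upper: "?q n \<le> 1" for n
  proof -
    have "card (CP_pos r (?w n)) \<le> card (CP r (?w n))"
      by (rule card_mono) (auto simp: finite_CP CP_pos_def)
    then show ?thesis by (intro divide_le_eq_1[THEN iffD2]) auto
  qed
  have "(\<lambda>n. (63/64::real) ^ (n - 2)) \<longlonglongrightarrow> 0"
    by (rule LIMSEQ_offset[where k = 2]) (simp add: LIMSEQ_realpow_zero)
  then have "(\<lambda>n. 1 - (63/64::real) ^ (n - 2)) \<longlonglongrightarrow> 1"
    by (auto intro: tendsto_eq_intros)
  then show ?thesis
  proof (rule real_tendsto_sandwich[rotated 2])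
    show "\<forall>\<^sub>F n in sequentially. 1 - (63/64) ^ (n - 2) \<le> ?q n"
      using lower by (auto simp: eventually_sequentially)
    show "\<forall>\<^sub>F n in sequentially. ?q n \<le> 1" using upper by simp
  qed simp
next
  case False
  have "CP_pos r (monomial_path r \<alpha> \<beta> n) = CP r (monomial_path r \<alpha> \<beta> n)" for n
    using False
    by (auto simp: CP_pos_def CP_def monomial_path_def max_dyck_eq floor_path_def vedges_def)
  moreover have "real (card (CP r w)) / real (card (CP r w)) = 1" for w
    using finite_CP[of r w] empty_in_CP[of r w] by (intro divide_self) auto
  ultimately show ?thesis by (simp only: tendsto_const)
qed

end
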